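(* Let $1\le k<n$, let $F$ be a real 2-uniform $(n,k)$-frame, and let $3\le m\le n$ be such that the associated graph $G_F$ does not have an induced complete bipartite subgraph on $m$ vertices. Then $$e_m^\infty(F)\le \frac{k}{n}+c_{n,k}\left(\frac{m}{2}-2+\sqrt{\frac{m^2}{4}+m-3}\right),\qquad c_{n,k}=\sqrt{\frac{k(n-k)}{n^2(n-1)}}.$$ If, in addition, $G_F$ contains an induced subgraph on $m$ vertices that differs from a complete bipartite graph by one edge, then equality holds.
   Context: A real $(n,k)$-frame is a family $F=\{f_1,\dots,f_n\}$ of $n$ vectors in $\mathbb{R}^k$ that is Parseval: $\|x\|^2=\sum_j|\langle x,f_j\rangle|^2$ for all $x\in\mathbb{R}^k$. Its analysis operator is $V:\mathbb{R}^k\to\mathbb{R}^n$, $(Vx)_i=\langle x,f_i\rangle$. It is uniform if all $\|f_j\|$ are equal (then $\|f_j\|^2=k/n$). Let $\mathcal{D}_m$ be the set of $n\times n$ diagonal matrices with exactly $m$ diagonal entries equal to $1$ and $n-m$ equal to $0$. $F$ is 2-uniform if it is uniform and $\|V^*DV\|$ is the same for all $D\in\mathcal{D}_2$. Norms of matrices are operator norms. Define $e_m^\infty(F)=\max\{\|V^*DV\|:D\in\mathcal{D}_m\}$. For a real 2-uniform $(n,k)$-frame, $|\langle f_j,f_i\rangle|=c_{n,k}$ for all $i\ne j$, and one writes $VV^*=\frac{k}{n}I_n+c_{n,k}Q$, where $Q$ (the signature matrix of $F$) is symmetric with zero diagonal and off-diagonal entries $\pm1$. The graph $G_F$ has vertex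 set $\{1,\dots,n\}$ and distinct $i,j$ are adjacent iff $q_{i,j}=-1$ (so $Q$ is the Seidel adjacency matrix of $G_F$). A graph on $m$ vertices is called complete bipartite if its vertex set is a disjoint union $V_1\cup V_2$, where one of $V_1,V_2$ may be empty, such that no two vertices within $V_1$ or within $V_2$ are adjacent and every vertex of $V_1$ is adjacent to every vertex of $V_2$. In particular the edgeless graph counts as complete bipartite. A graph differs from a complete bipartite graph by one edge if there is a complete bipartite graph on the same vertex set such that the two adjacency relations agree on all pairs of distinct vertices except exactly one pair. *)

theory Defs
  imports "HOL-Analysis.Analysis"
begin

section \<open>Real Parseval frames\<close>

text \<open>
  A real $(n,k)$-frame is a Parseval family of vectors in \<open>real ^ 'k\<close> indexed by \<open>'n\<close>, with
  $n$ = \<open>CARD('n)\<close> and $k$ = \<open>CARD('k)\<close>.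
\<close>

definition parseval_frame :: "('n::finite \<Rightarrow> real ^ 'k::finite) \<Rightarrow> bool" where
  "parseval_frame f \<longleftrightarrow> (\<forall>x. (norm x)\<^sup>2 = (\<Sum>j\<in>UNIV. \<bar>x \<bullet> f j\<bar>\<^sup>2))"

definition analysis_op :: "('n::finite \<Rightarrow> real ^ 'k::finite) \<Rightarrow> real ^ 'k \<Rightarrow> real ^ 'n" where
  "analysis_op f x = (\<chi> i. x \<bullet> f i)"

definition uniform_frame :: "('n::finite \<Rightarrow> real ^ 'k::finite) \<Rightarrow> bool" where
  "uniform_frame f \<longleftrightarrow> parseval_frame f \<and> (\<forall>i j. norm (f i) = norm (f j))"

definition diag01 :: "nat \<Rightarrow> (real ^ 'n ^ 'n) set" where
  "diag01 m = {D. (\<forall>i j. i \<noteq> j \<longrightarrow> D $ i $ j = 0) \<and> (\<forall>i. D $ i $ i = 0 \<or> D $ i $ i = 1)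
                  \<and> card {i. D $ i $ i = 1} = m}"

definition erasure_norm :: "('n::finite \<Rightarrow> real ^ 'k::finite) \<Rightarrow> real ^ 'n ^ 'n \<Rightarrow> real" where
  "erasure_norm f D = onorm (adjoint (analysis_op f) \<circ> (\<lambda>y. D *v y) \<circ> analysis_op f)"

definition two_uniform_frame :: "('n::finite \<Rightarrow> real ^ 'k::finite) \<Rightarrow> bool" where
  "two_uniform_frame f \<longleftrightarrow> uniform_frame f \<and>
     (\<forall>D\<in>diag01 2. \<forall>D'\<in>diag01 2. erasure_norm f D = erasure_norm f D')"

text \<open>The set maximised over is finite, and it is nonempty iff $m \le n$.\<close>

definition e_inf :: "nat \<Rightarrow> ('n::finite \<Rightarrow> real ^ 'k::finite) \<Rightarrow> real" where
  "e_inf m f = Max (erasure_norm f ` diag01 m)"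

section \<open>Signature matrix and graph of a 2-uniform frame\<close>

definition c_nk :: "nat \<Rightarrow> nat \<Rightarrow> real" where
  "c_nk n k = sqrt (real k * (real n - real k) / ((real n)\<^sup>2 * (real n - 1)))"

text \<open>
  For $1 \le k < n$ we have $c_{n,k} > 0$, so this is the unique $Q$ with
  $V V^* = \frac{k}{n} I + c_{n,k} Q$.
\<close>

definition signature_matrix :: "('n::finite \<Rightarrow> real ^ 'k::finite) \<Rightarrow> real ^ 'n ^ 'n" where
  "signature_matrix f =
     (1 / c_nk CARD('n) CARD('k)) *\<^sub>R
       (matrix (analysis_op f \<circ> adjoint (analysis_op f)) - (real CARD('k) / real CARD('n)) *\<^sub>R mat 1)"

text \<open>
  A simple graph is given by a vertex set and a set of edges, an edge being the two-element
  set of its endpoints. The vertex set of the graph of a frame is all of \<open>'n\<close>.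
\<close>

definition frame_graph_edges :: "('n::finite \<Rightarrow> real ^ 'k::finite) \<Rightarrow> 'n set set" where
  "frame_graph_edges f = {{i, j} | i j. i \<noteq> j \<and> signature_matrix f $ i $ j = -1}"

definition simple_graph :: "'a set \<Rightarrow> 'a set set \<Rightarrow> bool" where
  "simple_graph S E \<longleftrightarrow> E \<subseteq> {{u, v} | u v. u \<in> S \<and> v \<in> S \<and> u \<noteq> v}"

definition induced_edges :: "'a set set \<Rightarrow> 'a set \<Rightarrow> 'a set set" where
  "induced_edges E S = {e \<in> E. e \<subseteq> S}"

text \<open>Either part may be empty, so edgeless graphs are complete bipartite.\<close>

definition complete_bipartite :: "'a set \<Rightarrow> 'a set set \<Rightarrow> bool" where
  "complete_bipartite S E \<longleftrightarrow> simple_graph S E \<and>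
     (\<exists>V1 V2. V1 \<union> V2 = S \<and> V1 \<inter> V2 = {} \<and>
        (\<forall>u\<in>V1. \<forall>v\<in>V1. {u, v} \<notin> E) \<and>
        (\<forall>u\<in>V2. \<forall>v\<in>V2. {u, v} \<notin> E) \<and>
        (\<forall>u\<in>V1. \<forall>v\<in>V2. {u, v} \<in> E))"

definition one_edge_from_complete_bipartite :: "'a set \<Rightarrow> 'a set set \<Rightarrow> bool" where
  "one_edge_from_complete_bipartite S E \<longleftrightarrow> simple_graph S E \<and>
     (\<exists>E'. complete_bipartite S E' \<and> card (sym_diff E E') = 1)"

end

theory Submission
  imports Defs
begin

text \<open>
  The norm of \<open>V\<^sup>* D V\<close>, where \<open>D\<close> is the coordinate projection to a set \<open>S\<close> of \<open>m\<close> indices, is the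
  largest eigenvalue of the Gram matrix \<open>k/n I + c Q\<^sub>S\<close> of the vectors indexed by \<open>S\<close>. Multiplying
  a test vector \<open>y\<close> by its signs switches \<open>Q\<^sub>S\<close> to a matrix \<open>Q'\<close> tested on \<open>|y|\<close>. As the induced graph
  is not complete bipartite, \<open>Q'\<close> has an entry \<open>-1\<close> in some off-diagonal position, so the quadratic
  form is at most that of the all-ones Seidel matrix with a single pair of entries negated. The
  largest eigenvalue of the latter is the positive root of
  \<open>\<lambda>\<^sup>2 - (m - 4) \<lambda> - (3 m - 7)\<close>, and it is attained when the graph is one edge away from
  complete bipartite.
\<close>

section \<open>Erasure norms as norms of frame operators of subfamilies\<close>

definition partial_frame_op :: "('n \<Rightarrow> real ^ 'k::finite) \<Rightarrow> 'n set \<Rightarrow> real ^ 'k \<Rightarrow> real ^ 'k" where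
  "partial_frame_op f S x = (\<Sum>i\<in>S. (x \<bullet> f i) *\<^sub>R f i)"

lemma adjoint_analysis_op: "adjoint (analysis_op f) = (\<lambda>y. \<Sum>i\<in>UNIV. (y $ i) *\<^sub>R f i)"
proof (rule adjoint_unique, intro allI)
  fix x y
  show "analysis_op f x \<bullet> y = x \<bullet> (\<Sum>i\<in>UNIV. (y $ i) *\<^sub>R f i)"
    by (simp add: inner_vec_def[of "vec_lambda _"] analysis_op_def inner_sum_right mult.commute)
qed

lemma linear_partial_frame_op: "linear (partial_frame_op f S)"
  by (rule linearI)
    (auto simp: partial_frame_op_def inner_add_left scaleR_left_distrib sum.distrib scaleR_sum_right)

lemma erasure_norm_diag01:
  fixes f :: "'n::finite \<Rightarrow> real ^ 'k::finite"
  assumes "D \<in> diag01 m"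
  shows "erasure_norm f D = onorm (partial_frame_op f {i. D $ i $ i = 1})"
proof -
  have off: "D $ i $ j = 0" if "i \<noteq> j" for i j
    using assms that unfolding diag01_def by auto
  have diag: "D $ i $ i = 0 \<or> D $ i $ i = 1" for i
    using assms unfolding diag01_def by auto
  have "(D *v y) $ i = (if D $ i $ i = 1 then y $ i else 0)" for y i
  proof -
    have "(D *v y) $ i = (\<Sum>j\<in>UNIV. if j = i then D $ i $ i * y $ i else 0)"
      unfolding matrix_vector_mult_def vec_lambda_beta by (intro sum.cong) (auto simp: off)
    then show ?thesis using diag[of i] by auto
  qed
  then have "adjoint (analysis_op f) ((\<lambda>y. D *v y) (analysis_op f x)) =
      partial_frame_op f {i. D $ i $ i = 1} x" for x
    unfolding adjoint_analysis_op partial_frame_op_def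
    by (intro sum.mono_neutral_cong_right) (auto simp: analysis_op_def)
  then have "adjoint (analysis_op f) \<circ> (\<lambda>y. D *v y) \<circ> analysis_op f =
      partial_frame_op f {i. D $ i $ i = 1}"
    by (simp add: fun_eq_iff)
  then show ?thesis unfolding erasure_norm_def by simp
qed

lemma erasure_norm_image_diag01:
  fixes f :: "'n::finite \<Rightarrow> real ^ 'k::finite"
  shows "erasure_norm f ` diag01 m = (\<lambda>S. onorm (partial_frame_op f S)) ` {S. card S = m}"
proof (intro equalityI subsetI)
  fix r assume "r \<in> erasure_norm f ` diag01 m"
  then obtain D where D: "D \<in> diag01 m" "r = erasure_norm f D" by auto
  moreover have "card {i. D $ i $ i = 1} = m" using D(1) by (simp add: diag01_def)
  ultimately show "r \<in> (\<lambda>S. onorm (partial_frame_op f S)) ` {S. card S = m}"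
    by (auto simp: erasure_norm_diag01)
next
  fix r assume "r \<in> (\<lambda>S. onorm (partial_frame_op f S)) ` {S. card S = m}"
  then obtain S where S: "card S = m" "r = onorm (partial_frame_op f S)" by auto
  define D :: "real ^ 'n ^ 'n" where "D = (\<chi> i j. if i = j \<and> i \<in> S then 1 else 0)"
  have eq: "{i. D $ i $ i = 1} = S" by (auto simp: D_def)
  then have "D \<in> diag01 m" using S by (auto simp: diag01_def D_def)
  then show "r \<in> erasure_norm f ` diag01 m"
    using erasure_norm_diag01[of D m f] S eq by force
qed

lemma partial_frame_op_inner_self:
  "partial_frame_op f S x \<bullet> x = (\<Sum>i\<in>S. (x \<bullet> f i)\<^sup>2)"
  by (simp add: partial_frame_op_def inner_sum_left inner_sum_right power2_eq_square
      inner_commute[of _ x])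

text \<open>Taking \<open>y i = x \<bullet> f i\<close> in the Gram form gives
  \<open>|T x|^2 \<le> B (T x \<bullet> x)\<close> for the partial frame operator \<open>T\<close>;
  Cauchy-Schwarz and division by \<open>|T x|\<close> finish. This transfers an upper bound from the
  Gram matrix to the operator without the spectral theorem.\<close>

lemma onorm_partial_frame_op_le:
  assumes "\<And>y. (\<Sum>i\<in>S. \<Sum>j\<in>S. y i * y j * (f i \<bullet> f j)) \<le> B * (\<Sum>i\<in>S. (y i)\<^sup>2)"
    and "0 \<le> B"
  shows "onorm (partial_frame_op f S) \<le> B"
proof (rule onorm_le)
  fix x
  let ?T = "partial_frame_op f S x"
  have "(norm ?T)\<^sup>2 = (\<Sum>i\<in>S. \<Sum>j\<in>S. (x \<bullet> f i) * (x \<bullet> f j) * (f i \<bullet> f j))"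
    unfolding power2_norm_eq_inner
    by (simp add: partial_frame_op_def inner_sum_left inner_sum_right sum_distrib_left mult_ac)
      (subst sum.swap, intro sum.cong refl, simp add: inner_commute)
  also have "\<dots> \<le> B * (?T \<bullet> x)"
    unfolding partial_frame_op_inner_self by (rule assms(1))
  also have "\<dots> \<le> B * (norm ?T * norm x)"
    by (intro mult_left_mono norm_cauchy_schwarz assms)
  finally have "norm ?T * norm ?T \<le> norm ?T * (B * norm x)"
    by (simp add: power2_eq_square mult_ac)
  then show "norm ?T \<le> B * norm x"
    using assms(2) by (cases "norm ?T = 0") (auto simp: mult_le_cancel_left)
qed

text \<open>An eigenvector \<open>y\<close> of the Gram matrix is synthesised into
  \<open>x = \<Sum> y j f j\<close>. Then \<open>x \<bullet> f i = B * y i\<close>, which makes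
  \<open>x\<close> an eigenvector of the operator for the same \<open>B\<close>, and nonzero because
  \<open>B * y i0\<close> is.\<close>

lemma onorm_partial_frame_op_ge:
  fixes f :: "'n::finite \<Rightarrow> real ^ 'k::finite"
  assumes eig: "\<And>i. i \<in> S \<Longrightarrow> (\<Sum>j\<in>S. y j * (f i \<bullet> f j)) = B * y i"
    and "i0 \<in> S" "y i0 \<noteq> 0" "0 < B"
  shows "B \<le> onorm (partial_frame_op f S)"
proof -
  define x where "x = (\<Sum>j\<in>S. y j *\<^sub>R f j)"
  have xf: "x \<bullet> f i = B * y i" if "i \<in> S" for i
  proof -
    have "x \<bullet> f i = (\<Sum>j\<in>S. y j * (f j \<bullet> f i))" by (simp add: x_def inner_sum_left)
    also have "\<dots> = B * y i" using eig[OF that] by (simp add: inner_commute)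
    finally show ?thesis .
  qed
  have Tx: "partial_frame_op f S x = B *\<^sub>R x"
    unfolding partial_frame_op_def by (simp add: xf) (simp add: x_def scaleR_sum_right)
  have "x \<noteq> 0" using xf[OF assms(2)] assms by auto
  moreover have "norm (partial_frame_op f S x) \<le> onorm (partial_frame_op f S) * norm x"
    by (intro onorm linear_conv_bounded_linear[THEN iffD1] linear_partial_frame_op)
  ultimately show ?thesis using assms(4) by (simp add: Tx)
qed

section \<open>Inner products in a 2-uniform frame\<close>

lemma onorm_partial_frame_op_pair:
  fixes f :: "'n::finite \<Rightarrow> real ^ 'k::finite"
  assumes "i \<noteq> j" and norms: "norm (f i) = r" "norm (f j) = r" and "r > 0"
  shows "onorm (partial_frame_op f {i, j}) = r\<^sup>2 + \<bar>f i \<bullet> f j\<bar>"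
proof (rule antisym)
  have d: "f i \<bullet> f i = r\<^sup>2" "f j \<bullet> f j = r\<^sup>2"
    using norms by (simp_all flip: power2_norm_eq_inner)
  define g where "g = f i \<bullet> f j"
  have g: "f i \<bullet> f j = g" "f j \<bullet> f i = g" by (simp_all add: g_def inner_commute)
  show "onorm (partial_frame_op f {i, j}) \<le> r\<^sup>2 + \<bar>f i \<bullet> f j\<bar>"
  proof (rule onorm_partial_frame_op_le)
    fix y :: "'n \<Rightarrow> real"
    have "2 * (y i * y j * g) \<le> 2 * \<bar>y i * y j\<bar> * \<bar>g\<bar>"
      by (simp add: abs_mult[symmetric] mult.assoc)
    also have "\<dots> \<le> ((y i)\<^sup>2 + (y j)\<^sup>2) * \<bar>g\<bar>"
      using sum_squares_bound[of "\<bar>y i\<bar>" "\<bar>y j\<bar>"]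
      by (intro mult_right_mono) (simp_all add: abs_mult)
    finally show "(\<Sum>l\<in>{i, j}. \<Sum>l'\<in>{i, j}. y l * y l' * (f l \<bullet> f l'))
        \<le> (r\<^sup>2 + \<bar>f i \<bullet> f j\<bar>) * (\<Sum>l\<in>{i, j}. (y l)\<^sup>2)"
      using assms(1) by (simp add: d g) (simp add: algebra_simps power2_eq_square)
  qed simp
  \<comment> \<open>The vector with entries 1 and the sign of \<open>g\<close> is a top eigenvector
    of the 2 by 2 Gram matrix with diagonal \<open>r\<^sup>2\<close> and off-diagonal entry
    \<open>g\<close>.\<close>
  define y where "y = (\<lambda>l. if l = i then 1 else if g \<ge> 0 then 1 else - 1 :: real)"
  show "r\<^sup>2 + \<bar>f i \<bullet> f j\<bar> \<le> onorm (partial_frame_op f {i, j})"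
  proof (rule onorm_partial_frame_op_ge[where y = y and ?i0.0 = i])
    fix l assume "l \<in> {i, j}"
    then show "(\<Sum>j\<in>{i, j}. y j * (f l \<bullet> f j)) = (r\<^sup>2 + \<bar>f i \<bullet> f j\<bar>) * y l"
      using assms(1) by (auto simp: d g y_def)
  next
    show "0 < r\<^sup>2 + \<bar>f i \<bullet> f j\<bar>" using \<open>r > 0\<close> by (simp add: add_pos_nonneg)
  qed (auto simp: y_def)
qed

lemma parseval_frame_norm:
  assumes "parseval_frame f"
  shows "(\<Sum>j\<in>UNIV. (x \<bullet> f j)\<^sup>2) = x \<bullet> x"
  using assms by (simp add: parseval_frame_def flip: power2_norm_eq_inner)

text \<open>A trace computation: the squared norms of the frame vectors add up to the trace of
  \<open>V\<^sup>* V = I\<close>, which is \<open>k\<close>. It is carried out by swapping the sum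
  over the frame with the sum over an orthonormal basis.\<close>

lemma uniform_frame_norm:
  fixes f :: "'n::finite \<Rightarrow> real ^ 'k::finite"
  assumes "uniform_frame f"
  shows "f i \<bullet> f i = real CARD('k) / real CARD('n)"
proof -
  have P: "parseval_frame f" using assms by (simp add: uniform_frame_def)
  have norm_eq: "f j \<bullet> f j = f i \<bullet> f i" for j
  proof -
    have "norm (f j) = norm (f i)" using assms unfolding uniform_frame_def by blast
    then show ?thesis by (simp flip: power2_norm_eq_inner)
  qed
  have "real CARD('n) * (f i \<bullet> f i) = (\<Sum>j\<in>(UNIV :: 'n set). f i \<bullet> f i)"
    by simp
  also have "\<dots> = (\<Sum>j\<in>UNIV. f j \<bullet> f j)"
    by (intro sum.cong refl norm_eq[symmetric])
  also have "\<dots> = (\<Sum>j\<in>UNIV. \<Sum>b\<in>(Basis :: (real ^ 'k) set). (b \<bullet> f j)\<^sup>2)"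
  proof (rule sum.cong)
    fix j
    show "f j \<bullet> f j = (\<Sum>b\<in>Basis. (b \<bullet> f j)\<^sup>2)"
      unfolding euclidean_inner[of "f j" "f j"] by (simp add: power2_eq_square inner_commute)
  qed simp
  also have "\<dots> = (\<Sum>b\<in>(Basis :: (real ^ 'k) set). b \<bullet> b)"
    by (subst sum.swap) (simp add: parseval_frame_norm[OF P])
  also have "\<dots> = real CARD('k)"
    by (simp add: inner_same_Basis)
  finally show ?thesis by (simp add: field_simps)
qed

text \<open>Equal norms for all double erasures force equal \<open>|f i \<bullet> f j|\<close>,
  since the norm for a pair is \<open>k/n + |f i \<bullet> f j|\<close>. The Parseval identity at
  \<open>x = f i\<close> then reads \<open>k/n = (k/n)^2 + (n - 1) (f i \<bullet> f j)^2\<close> and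
  fixes the common value.\<close>

lemma two_uniform_frame_inner:
  fixes f :: "'n::finite \<Rightarrow> real ^ 'k::finite"
  assumes "two_uniform_frame f" and "i \<noteq> j"
  shows "\<bar>f i \<bullet> f j\<bar> = c_nk CARD('n) CARD('k)"
proof -
  let ?n = "real CARD('n)" and ?k = "real CARD('k)"
  have U: "uniform_frame f" using assms by (simp add: two_uniform_frame_def)
  then have P: "parseval_frame f" by (simp add: uniform_frame_def)
  note d = uniform_frame_norm[OF U]
  define r where "r = sqrt (?k / ?n)"
  have r: "r > 0" by (simp add: r_def)
  have nr: "norm (f l) = r" for l by (simp add: norm_eq_sqrt_inner d r_def)
  have pair: "onorm (partial_frame_op f {u, v}) = r\<^sup>2 + \<bar>f u \<bullet> f v\<bar>" if "u \<noteq> v" for u v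
    by (rule onorm_partial_frame_op_pair[OF that nr nr r])
  have mem: "onorm (partial_frame_op f {u, v}) \<in> erasure_norm f ` diag01 2" if "u \<noteq> v" for u v
    unfolding erasure_norm_image_diag01 using that by (auto intro!: imageI)
  have const: "\<bar>f u \<bullet> f v\<bar> = \<bar>f i \<bullet> f j\<bar>" if uv: "u \<noteq> v" for u v
  proof -
    obtain D D' where D: "D \<in> diag01 2" "onorm (partial_frame_op f {u, v}) = erasure_norm f D"
      and D': "D' \<in> diag01 2" "onorm (partial_frame_op f {i, j}) = erasure_norm f D'"
      using mem[OF uv] mem[OF assms(2)] by (meson imageE)
    have "erasure_norm f D = erasure_norm f D'"
      using assms(1) D(1) D'(1) unfolding two_uniform_frame_def by blast
    then show ?thesis
      using pair[OF uv] pair[OF assms(2)] D(2) D'(2) by simp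
  qed
  have n2: "?n > 1"
    using card_mono[of UNIV "{i, j}"] assms(2) by simp
  have "?k / ?n = (\<Sum>l\<in>UNIV. (f i \<bullet> f l)\<^sup>2)"
    by (simp add: parseval_frame_norm[OF P] d)
  also have "\<dots> = (f i \<bullet> f i)\<^sup>2 + (\<Sum>l\<in>UNIV - {i}. (f i \<bullet> f l)\<^sup>2)"
    by (simp add: sum.remove)
  also have "(\<Sum>l\<in>UNIV - {i}. (f i \<bullet> f l)\<^sup>2) = (\<Sum>l\<in>UNIV - {i}. (f i \<bullet> f j)\<^sup>2)"
    using const by (intro sum.cong refl) (metis DiffD2 insertI1 power2_abs)
  also have "\<dots> = (?n - 1) * (f i \<bullet> f j)\<^sup>2"
    using n2 by (simp add: card_Diff_singleton of_nat_diff)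
  finally have "?k / ?n = (?k / ?n)\<^sup>2 + (?n - 1) * (f i \<bullet> f j)\<^sup>2"
    by (simp add: d)
  then have "(f i \<bullet> f j)\<^sup>2 = ?k * (?n - ?k) / (?n\<^sup>2 * (?n - 1))"
    using n2 by (simp add: field_simps power2_eq_square)
  then show ?thesis
    unfolding c_nk_def by (metis real_sqrt_abs)
qed

lemma signature_matrix_component:
  fixes f :: "'n::finite \<Rightarrow> real ^ 'k::finite"
  assumes "i \<noteq> j"
  shows "signature_matrix f $ i $ j = (f i \<bullet> f j) / c_nk CARD('n) CARD('k)"
proof -
  have "(\<Sum>l\<in>UNIV. axis j 1 $ l *\<^sub>R f l) = (\<Sum>l\<in>UNIV. if l = j then f l else 0)"
    by (intro sum.cong) (auto simp: axis_def)
  then show ?thesis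
    using assms by (simp add: signature_matrix_def matrix_def mat_def adjoint_analysis_op
      analysis_op_def inner_commute)
qed

lemma c_nk_pos:
  assumes "0 < k" "k < n" "1 < n"
  shows "0 < c_nk n k"
  unfolding c_nk_def using assms by simp

lemma two_uniform_frame_gram:
  fixes f :: "'n::finite \<Rightarrow> real ^ 'k::finite"
  assumes "CARD('k) < CARD('n)" "two_uniform_frame f" "i \<noteq> j"
  shows "f i \<bullet> f j = c_nk CARD('n) CARD('k) * (if {i, j} \<in> frame_graph_edges f then - 1 else 1)"
proof -
  let ?c = "c_nk CARD('n) CARD('k)"
  have c: "?c > 0"
    using assms(1) c_nk_pos[of "CARD('k)" "CARD('n)"] zero_less_card_finite[where 'a='k] by linarith
  \<comment> \<open>Edges are unordered, so an edge \<open>{i, j}\<close> gives an entry -1 at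
    \<open>(i, j)\<close> or at \<open>(j, i)\<close>; symmetry merges the two.\<close>
  have "signature_matrix f $ j $ i = signature_matrix f $ i $ j"
    using assms(3) by (simp add: signature_matrix_component inner_commute)
  then have "{i, j} \<in> frame_graph_edges f \<longleftrightarrow> signature_matrix f $ i $ j = - 1"
    unfolding frame_graph_edges_def using assms(3) by (auto simp: doubleton_eq_iff)
  also have "\<dots> \<longleftrightarrow> f i \<bullet> f j = - ?c"
    using c assms(3) by (simp add: signature_matrix_component divide_eq_eq)
  finally show ?thesis
    using two_uniform_frame_inner[OF assms(2,3)] by (auto simp: abs_if split: if_splits)
qed

section \<open>Largest eigenvalue of the all-ones Seidel matrix with one pair negated\<close>

definition seidel_bound :: "nat \<Rightarrow> real" where
  "seidel_bound m = real m / 2 - 2 + sqrt ((real m)\<^sup>2 / 4 + real m - 3)"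

text \<open>With \<open>N = m - 2\<close>, a vector equal to \<open>p\<close> on the negated pair
  and to \<open>q\<close> elsewhere is an eigenvector for \<open>L\<close> iff
  \<open>(L + 1) p = N q\<close> and \<open>(L + 1 - N) q = 2 p\<close>. Multiplying these two
  equations yields this form of the characteristic equation.\<close>

lemma seidel_bound_eq:
  assumes "3 \<le> m"
  shows "(seidel_bound m + 1) * (seidel_bound m + 1 - (real m - 2)) = 2 * (real m - 2)"
proof -
  define s where "s = sqrt ((real m)\<^sup>2 / 4 + real m - 3)"
  have s2: "s\<^sup>2 = (real m)\<^sup>2 / 4 + real m - 3"
  proof -
    have "3 \<le> real m" "0 \<le> (real m)\<^sup>2 / 4" using assms by simp_all
    then have "0 \<le> (real m)\<^sup>2 / 4 + real m - 3" by linarith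
    then show ?thesis unfolding s_def by (rule real_sqrt_pow2)
  qed
  have "(seidel_bound m + 1) * (seidel_bound m + 1 - (real m - 2)) =
      (s + (real m / 2 - 1)) * (s - (real m / 2 - 1))"
    unfolding seidel_bound_def s_def[symmetric] by (simp add: field_simps)
  also have "\<dots> = s\<^sup>2 - (real m / 2 - 1)\<^sup>2"
    by (simp add: power2_eq_square field_simps)
  also have "\<dots> = 2 * (real m - 2)"
    unfolding s2 by (simp add: power2_eq_square algebra_simps)
  finally show ?thesis .
qed

text \<open>The value 1 is the eigenvalue on the difference of the unit vectors of the negated pair,
  which the bound must dominate. The second inequality makes both factors in
  \<open>seidel_bound_eq\<close> positive. Both follow because the square root is at least
  \<open>m/2\<close> for \<open>m \<ge> 3\<close>.\<close>

lemma seidel_bound_ge: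
  assumes "3 \<le> m"
  shows "seidel_bound m \<ge> 1" "seidel_bound m > real m - 3"
proof -
  have "real m / 2 \<le> sqrt ((real m)\<^sup>2 / 4 + real m - 3)"
    using assms by (intro real_le_rsqrt) (simp add: power_divide)
  then have ge: "seidel_bound m \<ge> real m - 2" by (simp add: seidel_bound_def)
  then show "seidel_bound m \<ge> 1" "seidel_bound m > real m - 3" using assms by auto
qed

lemma sum_sum_offdiag:
  fixes y :: "'a \<Rightarrow> real"
  assumes "finite S"
  shows "(\<Sum>i\<in>S. \<Sum>j\<in>S. if i = j then 0 else y i * y j) = (sum y S)\<^sup>2 - (\<Sum>i\<in>S. (y i)\<^sup>2)"
proof -
  have "(\<Sum>i\<in>S. \<Sum>j\<in>S. if i = j then 0 else y i * y j) =
      (\<Sum>i\<in>S. \<Sum>j\<in>S. y i * y j - (if i = j then (y i)\<^sup>2 else 0))"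
    by (intro sum.cong) (auto simp: power2_eq_square)
  also have "\<dots> = (sum y S)\<^sup>2 - (\<Sum>i\<in>S. (y i)\<^sup>2)"
    using assms by (simp add: sum_subtractf sum_product power2_eq_square)
  finally show ?thesis .
qed

lemma sum_sum_single:
  fixes z :: "'b::comm_monoid_add"
  assumes "finite S" "a \<in> S" "b \<in> S"
  shows "(\<Sum>i\<in>S. \<Sum>j\<in>S. if i = a \<and> j = b then z else 0) = z"
proof -
  have "(\<Sum>j\<in>S. if i = a \<and> j = b then z else 0) = (if i = a then z else 0)" for i
    using assms by (cases "i = a") simp_all
  then show ?thesis using assms by simp
qed

text \<open>The first two terms are the form of the all-ones Seidel matrix; negating the entries at
  \<open>(u, v)\<close> and \<open>(v, u)\<close> costs \<open>2 * y u * y v\<close> each. The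
  difference of the two sides is a sum of squares plus the slack of a Cauchy-Schwarz
  inequality.\<close>

lemma seidel_one_pair_bound:
  fixes y :: "'a \<Rightarrow> real"
  assumes S: "finite S" "card S = m" "3 \<le> m" and uv: "u \<in> S" "v \<in> S" "u \<noteq> v"
  shows "(sum y S)\<^sup>2 - (\<Sum>i\<in>S. (y i)\<^sup>2) - 4 * y u * y v \<le> seidel_bound m * (\<Sum>i\<in>S. (y i)\<^sup>2)"
proof -
  let ?R = "S - {u} - {v}"
  define L where "L = seidel_bound m"
  define N where "N = real m - 2"
  define T where "T = sum y ?R"
  define W where "W = (\<Sum>i\<in>?R. (y i)\<^sup>2)"
  define p where "p = y u + y v"
  have split: "sum g S = g u + (g v + sum g ?R)" for g :: "'a \<Rightarrow> real"
    using sum.remove[of S u g] sum.remove[of "S - {u}" v g] S(1) uv by simp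
  have s: "sum y S = y u + (y v + T)" "(\<Sum>i\<in>S. (y i)\<^sup>2) = (y u)\<^sup>2 + ((y v)\<^sup>2 + W)"
    unfolding T_def W_def by (rule split)+
  have card: "real (card ?R) = N"
    using S uv by (simp add: N_def card_Diff_singleton)
  have N: "N > 0" using S by (simp add: N_def)
  have L: "L \<ge> 1" "L + 1 - N > 0" "(L + 1) * (L + 1 - N) = 2 * N"
    using seidel_bound_ge[OF S(3)] unfolding L_def N_def
    seidel_bound_eq[OF S(3)] by simp_all
  \<comment> \<open>The coordinates outside the pair enter the form only through \<open>T\<close>
    and \<open>W\<close>; for given \<open>T\<close>, \<open>W\<close> is least when they are all
    equal.\<close>
  have W: "T\<^sup>2 / N \<le> W"
    using Cauchy_Schwarz_ineq_sum[of "\<lambda>_. 1" y ?R] N card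
    by (simp add: T_def W_def divide_le_eq mult.commute)
  \<comment> \<open>This is the value of \<open>p\<close> minimising
    \<open>(L + 1) / 2 * p\<^sup>2 - 2 * p * T\<close>.\<close>
  define z where "z = 2 * T / (L + 1)"
  have z: "(L + 1) * z = 2 * T" using L(1) by (simp add: z_def)
  have "0 \<le> (L + 1) / 2 * (p - z)\<^sup>2"
    using L(1) by simp
  also have "\<dots> = (L + 1) / 2 * p\<^sup>2 - p * ((L + 1) * z) + (L + 1) * z * z / 2"
    by (simp add: power2_eq_square field_simps)
  also have "\<dots> = (L + 1) / 2 * p\<^sup>2 - 2 * p * T + 2 * T\<^sup>2 / (L + 1)"
    unfolding z using L(1) by (simp add: z_def power2_eq_square field_simps)
  \<comment> \<open>The characteristic equation enters here: it turns the minimum into a multiple of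
    \<open>T\<^sup>2 / N\<close>, to which Cauchy-Schwarz applies.\<close>
  also have "2 * T\<^sup>2 / (L + 1) = (L + 1) * (T\<^sup>2 / N) - T\<^sup>2"
  proof -
    have "2 / (L + 1) = (L + 1 - N) / N"
      using L N by (subst frac_eq_eq) (auto simp: mult.commute)
    also have "\<dots> = (L + 1) / N - 1" using N by (simp add: diff_divide_distrib)
    finally have "2 / (L + 1) = (L + 1) / N - 1" .
    then have "T\<^sup>2 * (2 / (L + 1)) = T\<^sup>2 * ((L + 1) / N - 1)" by simp
    then show ?thesis by (simp add: algebra_simps)
  qed
  also have "(L + 1) * (T\<^sup>2 / N) \<le> (L + 1) * W"
    using W L(1) by (intro mult_left_mono) auto
  finally have "0 \<le> (L + 1) / 2 * p\<^sup>2 - 2 * p * T + (L + 1) * W - T\<^sup>2" by simp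
  \<comment> \<open>The part antisymmetric in \<open>u\<close> and \<open>v\<close>, where the
    matrix has eigenvalue 1.\<close>
  moreover have "0 \<le> (L - 1) / 2 * (y u - y v)\<^sup>2" using L(1) by simp
  ultimately have "0 \<le> ((L + 1) / 2 * p\<^sup>2 - 2 * p * T + (L + 1) * W - T\<^sup>2) + (L - 1) / 2 * (y u - y v)\<^sup>2"
    by linarith
  also have "\<dots> = L * ((y u)\<^sup>2 + ((y v)\<^sup>2 + W)) -
      ((y u + (y v + T))\<^sup>2 - ((y u)\<^sup>2 + ((y v)\<^sup>2 + W)) - 4 * y u * y v)"
    by (simp add: p_def power2_eq_square field_simps)
  finally show ?thesis by (simp add: s L_def)
qed

section \<open>Complete bipartite graphs as switchings of the edgeless graph\<close>

lemma simple_graph_not_loop: "simple_graph S E \<Longrightarrow> {u} \<notin> E"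
  by (auto simp: simple_graph_def)

text \<open>The signs mark the two parts. In matrix terms, the Seidel matrix agrees off the diagonal
  with a rank-one matrix of signs, a form that can be compared with the signs of a test
  vector.\<close>

lemma complete_bipartite_sign_iff:
  "complete_bipartite S E \<longleftrightarrow> simple_graph S E \<and>
    (\<exists>s :: 'a \<Rightarrow> real. (\<forall>u. s u = 1 \<or> s u = - 1) \<and>
      (\<forall>u\<in>S. \<forall>v\<in>S. u \<noteq> v \<longrightarrow> s u * s v = (if {u, v} \<in> E then - 1 else 1)))"
  (is "_ \<longleftrightarrow> _ \<and> (\<exists>s. ?P s)")
proof (intro iffI conjI; (elim conjE exE)?)
  assume *: "complete_bipartite S E"
  then show "simple_graph S E" by (simp add: complete_bipartite_def)
  from * obtain V1 V2 where V: "V1 \<union> V2 = S" "V1 \<inter> V2 = {}"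
    "\<forall>u\<in>V1. \<forall>v\<in>V1. {u, v} \<notin> E" "\<forall>u\<in>V2. \<forall>v\<in>V2. {u, v} \<notin> E" "\<forall>u\<in>V1. \<forall>v\<in>V2. {u, v} \<in> E"
    unfolding complete_bipartite_def by blast
  have V': "{u, v} \<in> E" if "u \<in> V2" "v \<in> V1" for u v
    using V(5) that by (subst insert_commute) blast
  have "?P (\<lambda>u. if u \<in> V1 then 1 else - 1)"
  proof (intro conjI allI ballI impI)
    fix u v assume "u \<in> S" "v \<in> S"
    moreover have "w \<notin> V1" if "w \<in> V2" for w using V(2) that by blast
    ultimately consider "u \<in> V1" "v \<in> V1" | "u \<in> V1" "v \<in> V2" "v \<notin> V1"
      | "u \<in> V2" "u \<notin> V1" "v \<in> V1" | "u \<in> V2" "v \<in> V2" "u \<notin> V1" "v \<notin> V1"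
      using V(1) by blast
    then show "(if u \<in> V1 then 1 else - 1) * (if v \<in> V1 then 1 else - 1) =
        (if {u, v} \<in> E then - 1 else (1 :: real))"
      by cases (use V(3,4,5) V' in simp_all)
  qed simp
  then show "\<exists>s. ?P s" by (rule exI[where x = "\<lambda>u. if u \<in> V1 then 1 else - 1"])
next
  fix s :: "'a \<Rightarrow> real"
  assume g: "simple_graph S E" and s: "\<forall>u. s u = 1 \<or> s u = - 1"
    "\<forall>u\<in>S. \<forall>v\<in>S. u \<noteq> v \<longrightarrow> s u * s v = (if {u, v} \<in> E then - 1 else 1)"
  \<comment> \<open>The case \<open>u = v\<close> is included because the parts in
    \<open>complete_bipartite\<close> are tested on equal vertices too; there \<open>{u, u}\<close>
    is a loop, which a simple graph lacks.\<close>
  have e: "{u, v} \<in> E \<longleftrightarrow> s u \<noteq> s v" if "u \<in> S" "v \<in> S" for u v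
  proof (cases "u = v")
    case True
    then show ?thesis using simple_graph_not_loop[OF g] by simp
  next
    case False
    then have "s u * s v = (if {u, v} \<in> E then - 1 else 1)" using s(2) that by simp
    moreover have "s u = 1 \<or> s u = - 1" "s v = 1 \<or> s v = - 1" using s(1) by simp_all
    ultimately show ?thesis by (auto split: if_splits)
  qed
  show "complete_bipartite S E"
    unfolding complete_bipartite_def
  proof (rule conjI[OF g], rule exI[of _ "{u \<in> S. s u = 1}"],
      rule exI[of _ "{u \<in> S. s u = - 1}"], intro conjI)
    show "{u \<in> S. s u = 1} \<union> {u \<in> S. s u = - 1} = S" using s(1) by blast
  qed (simp_all add: e disjoint_iff)
qed

lemma simple_graph_induced_frame_graph: "simple_graph S (induced_edges (frame_graph_edges f) S)"
  by (auto simp: simple_graph_def induced_edges_def frame_graph_edges_def)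

section \<open>Norm bounds from the induced subgraph\<close>

lemma onorm_le_of_not_complete_bipartite:
  fixes f :: "'n::finite \<Rightarrow> real ^ 'k::finite"
  assumes k: "CARD('k) < CARD('n)" and F: "two_uniform_frame f"
    and S: "card S = m" "3 \<le> m"
    and nb: "\<not> complete_bipartite S (induced_edges (frame_graph_edges f) S)"
  shows "onorm (partial_frame_op f S) \<le>
    real CARD('k) / real CARD('n) + c_nk CARD('n) CARD('k) * seidel_bound m"
proof (rule onorm_partial_frame_op_le)
  let ?c = "c_nk CARD('n) CARD('k)" and ?d = "real CARD('k) / real CARD('n)"
  let ?E = "frame_graph_edges f"
  have U: "uniform_frame f" using F by (simp add: two_uniform_frame_def)
  have c: "?c > 0"
    using k c_nk_pos[of "CARD('k)" "CARD('n)"] zero_less_card_finite[where 'a='k] by linarith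
  show "0 \<le> ?d + ?c * seidel_bound m"
    using c seidel_bound_ge(1)[OF S(2)] by simp
  fix y :: "'n \<Rightarrow> real"
  \<comment> \<open>Zero coordinates get sign 1, so that \<open>s\<close> takes only the values 1
    and -1, as \<open>complete_bipartite_sign_iff\<close> requires.\<close>
  define s where "s i = (if y i \<ge> 0 then 1 else - 1 :: real)" for i
  define q where "q i j = (if {i, j} \<in> ?E then - 1 else 1 :: real)" for i j
  \<comment> \<open>Otherwise \<open>s\<close> itself would exhibit the induced graph as complete
    bipartite.\<close>
  have "\<exists>u\<in>S. \<exists>v\<in>S. u \<noteq> v \<and> s u * s v \<noteq> q u v"
  proof (rule ccontr)
    assume "\<not> ?thesis"
    then have "s u * s v = q u v" if "u \<in> S" "v \<in> S" "u \<noteq> v" for u v using that by blast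
    then have "\<forall>u\<in>S. \<forall>v\<in>S. u \<noteq> v \<longrightarrow> s u * s v = (if {u, v} \<in> induced_edges ?E S then - 1 else 1)"
      by (simp add: induced_edges_def q_def)
    moreover have "\<forall>u. s u = 1 \<or> s u = - 1" by (simp add: s_def)
    ultimately show False
      using nb simple_graph_induced_frame_graph[of S f] unfolding complete_bipartite_sign_iff by blast
  qed
  then obtain u v where uv: "u \<in> S" "v \<in> S" "u \<noteq> v" "s u * s v \<noteq> q u v" by blast
  have quv: "q u v = - (s u * s v)" "q v u = - (s u * s v)"
    using uv(4) by (auto simp: q_def s_def insert_commute split: if_splits)
  have ys: "y i * s i = \<bar>y i\<bar>" for i by (simp add: s_def)
  have neg: "y u * y v * q u v = - (\<bar>y u\<bar> * \<bar>y v\<bar>)" "y v * y u * q v u = - (\<bar>y u\<bar> * \<bar>y v\<bar>)"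
    unfolding quv ys[symmetric] by (simp_all add: mult_ac)
  \<comment> \<open>The summand of the form bounded in \<open>seidel_one_pair_bound\<close>, taken
    at \<open>|y|\<close>: at \<open>(u, v)\<close> and \<open>(v, u)\<close> subtracting twice the
    product turns the sign to -1.\<close>
  let ?t = "\<lambda>i j. (if i = j then 0 else \<bar>y i\<bar> * \<bar>y j\<bar>) -
      ((if i = u \<and> j = v then 2 * \<bar>y u\<bar> * \<bar>y v\<bar> else 0) +
       (if i = v \<and> j = u then 2 * \<bar>y u\<bar> * \<bar>y v\<bar> else 0))"
  have le: "(if i = j then 0 else y i * y j * q i j) \<le> ?t i j" for i j
  proof -
    have "y i * y j * q i j \<le> \<bar>y i\<bar> * \<bar>y j\<bar>"
      by (simp add: q_def abs_ge_self abs_ge_minus_self flip: abs_mult)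
    then show ?thesis using uv(3) neg by auto
  qed
  have "(\<Sum>i\<in>S. \<Sum>j\<in>S. if i = j then 0 else y i * y j * q i j) \<le> (\<Sum>i\<in>S. \<Sum>j\<in>S. ?t i j)"
    by (intro sum_mono le)
  also have "\<dots> = (\<Sum>i\<in>S. \<bar>y i\<bar>)\<^sup>2 - (\<Sum>i\<in>S. \<bar>y i\<bar>\<^sup>2) - 4 * \<bar>y u\<bar> * \<bar>y v\<bar>"
    unfolding sum_subtractf sum.distrib sum_sum_offdiag[OF finite]
      sum_sum_single[OF finite uv(1,2)] sum_sum_single[OF finite uv(2,1)] by simp
  also have "\<dots> \<le> seidel_bound m * (\<Sum>i\<in>S. \<bar>y i\<bar>\<^sup>2)"
    by (rule seidel_one_pair_bound[OF finite S uv(1-3)])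
  finally have key: "(\<Sum>i\<in>S. \<Sum>j\<in>S. if i = j then 0 else y i * y j * q i j)
      \<le> seidel_bound m * (\<Sum>i\<in>S. (y i)\<^sup>2)" by simp
  have "(\<Sum>i\<in>S. \<Sum>j\<in>S. y i * y j * (f i \<bullet> f j)) =
      (\<Sum>i\<in>S. \<Sum>j\<in>S. (if i = j then ?d * (y i)\<^sup>2 else 0) + ?c * (if i = j then 0 else y i * y j * q i j))"
    by (intro sum.cong refl)
      (auto simp: uniform_frame_norm[OF U] two_uniform_frame_gram[OF k F] q_def power2_eq_square)
  also have "\<dots> = ?d * (\<Sum>i\<in>S. (y i)\<^sup>2) +
      ?c * (\<Sum>i\<in>S. \<Sum>j\<in>S. if i = j then 0 else y i * y j * q i j)"
    by (simp add: sum.distrib sum_distrib_left)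
  also have "\<dots> \<le> ?d * (\<Sum>i\<in>S. (y i)\<^sup>2) + ?c * (seidel_bound m * (\<Sum>i\<in>S. (y i)\<^sup>2))"
    using key c by (intro add_left_mono mult_left_mono) auto
  finally show "(\<Sum>i\<in>S. \<Sum>j\<in>S. y i * y j * (f i \<bullet> f j)) \<le>
      (?d + ?c * seidel_bound m) * (\<Sum>i\<in>S. (y i)\<^sup>2)"
    by (simp add: algebra_simps)
qed

lemma onorm_ge_of_one_edge_from_complete_bipartite:
  fixes f :: "'n::finite \<Rightarrow> real ^ 'k::finite"
  assumes k: "CARD('k) < CARD('n)" and F: "two_uniform_frame f"
    and S: "card S = m" "3 \<le> m"
    and ob: "one_edge_from_complete_bipartite S (induced_edges (frame_graph_edges f) S)"
  shows "real CARD('k) / real CARD('n) + c_nk CARD('n) CARD('k) * seidel_bound m \<le>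
    onorm (partial_frame_op f S)"
proof -
  let ?c = "c_nk CARD('n) CARD('k)" and ?d = "real CARD('k) / real CARD('n)"
  let ?I = "induced_edges (frame_graph_edges f) S"
  define L where "L = seidel_bound m"
  have U: "uniform_frame f" using F by (simp add: two_uniform_frame_def)
  have c: "?c > 0"
    using k c_nk_pos[of "CARD('k)" "CARD('n)"] zero_less_card_finite[where 'a='k] by linarith
  obtain E' where E': "complete_bipartite S E'" and card_e: "card (sym_diff ?I E') = 1"
    using ob unfolding one_edge_from_complete_bipartite_def by blast
  from card_e obtain e where e: "sym_diff ?I E' = {e}"
    by (rule card_1_singletonE)
  have g': "simple_graph S E'" using E' by (simp add: complete_bipartite_def)
  from E'[unfolded complete_bipartite_sign_iff, THEN conjunct2]
  obtain s :: "'n \<Rightarrow> real" where sgn: "(\<forall>u. s u = 1 \<or> s u = - 1) \<and>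
    (\<forall>u\<in>S. \<forall>v\<in>S. u \<noteq> v \<longrightarrow> s u * s v = (if {u, v} \<in> E' then - 1 else 1))" ..
  have s: "s u = 1 \<or> s u = - 1" for u
    using sgn by simp
  have s_mult: "s u * s v = (if {u, v} \<in> E' then - 1 else 1)"
    if "u \<in> S" "v \<in> S" "u \<noteq> v" for u v
    using sgn that by simp
  \<comment> \<open>The induced graph arises from \<open>E'\<close> by toggling the single edge
    \<open>e\<close>.\<close>
  have mem_iff: "x \<in> ?I \<longleftrightarrow> (x \<in> E') \<noteq> (x = e)" for x
  proof -
    have "x \<in> sym_diff ?I E' \<longleftrightarrow> x = e" unfolding e by simp
    then show ?thesis by (simp only: Un_iff Diff_iff) argo
  qed
  \<comment> \<open>Since \<open>e\<close> is an edge of one of two simple graphs on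
    \<open>S\<close>, it is a pair of distinct vertices of \<open>S\<close>.\<close>
  then have "e \<in> ?I \<or> e \<in> E'" by simp
  then have "e \<in> {{u, v} | u v. u \<in> S \<and> v \<in> S \<and> u \<noteq> v}"
    using g' simple_graph_induced_frame_graph[of S f] unfolding simple_graph_def
    by (meson subsetD)
  then obtain u v where uv: "e = {u, v}" "u \<in> S" "v \<in> S" "u \<noteq> v" by blast
  have I_iff: "{i, j} \<in> ?I \<longleftrightarrow> ({i, j} \<in> E') \<noteq> ({i, j} = {u, v})" for i j
    unfolding uv(1)[symmetric] by (rule mem_iff)
  have gram: "f i \<bullet> f j = ?c * (s i * s j * (if {i, j} = {u, v} then - 1 else 1))"
    if "i \<in> S" "j \<in> S" "i \<noteq> j" for i j
  proof -
    have "{i, j} \<in> frame_graph_edges f \<longleftrightarrow> {i, j} \<in> ?I"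
      using that by (simp add: induced_edges_def)
    then show ?thesis
      using I_iff[of i j] s_mult[OF that] two_uniform_frame_gram[OF k F that(3)] by simp
  qed
  have ss: "s i * s i = 1" for i using s[of i] by auto
  define N where "N = real m - 2"
  have N: "N > 0" using S by (simp add: N_def)
  have L1: "L \<ge> 1" using seidel_bound_ge[OF S(2)] by (simp add: L_def)
  have L2: "(L + 1) * (L + 1 - N) = 2 * N"
    unfolding L_def N_def by (rule seidel_bound_eq[OF S(2)])
  \<comment> \<open>After switching by \<open>s\<close>, the top eigenvector is constant on \<open>{u, v}\<close> and on the rest of \<open>S\<close>; row
    \<open>u\<close> of the eigenvalue equation, \<open>L p = - p + N q\<close>, fixes the two values up to scaling.\<close>
  define a where "a i = (if i = u \<or> i = v then N else L + 1)" for i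
  have total: "sum a S = N * (L + 3)"
  proof -
    have "sum a S = a u + (a v + sum a (S - {u} - {v}))"
      using S uv by (subst sum.remove[of S u], simp, simp, subst sum.remove[of "S - {u}" v]) auto
    also have "sum a (S - {u} - {v}) = (\<Sum>i\<in>S - {u} - {v}. L + 1)"
      by (intro sum.cong) (auto simp: a_def)
    also have "\<dots> = N * (L + 1)"
      using S uv by (simp add: N_def card_Diff_singleton)
    finally show ?thesis by (simp add: a_def algebra_simps)
  qed
  show ?thesis
    unfolding L_def[symmetric]
  proof (rule onorm_partial_frame_op_ge[where y = "\<lambda>i. s i * a i" and ?i0.0 = u])
    show "u \<in> S" by fact
    show "s u * a u \<noteq> 0" using s[of u] N by (auto simp: a_def)
    show "0 < ?d + ?c * L" using c L1 by (intro add_nonneg_pos) auto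
    fix i assume i: "i \<in> S"
    \<comment> \<open>Negating the entry at the pair replaces \<open>a j = N\<close> by
      \<open>-N\<close>, a loss of \<open>2 * N\<close>. Below, the sum of all \<open>a j\<close>
      also counts \<open>j = i\<close> with weight \<open>?c\<close>, hence the diagonal correction
      \<open>?d - ?c\<close>.\<close>
    let ?r = "\<lambda>j. if i = u \<and> j = v \<or> i = v \<and> j = u then 2 * N else 0"
    have "(\<Sum>j\<in>S. s j * a j * (f i \<bullet> f j)) =
        (\<Sum>j\<in>S. (if j = i then (?d - ?c) * (s i * a i) else 0) + ?c * s i * (a j - ?r j))"
    proof (intro sum.cong refl)
      fix j assume j: "j \<in> S"
      show "s j * a j * (f i \<bullet> f j) =
          (if j = i then (?d - ?c) * (s i * a i) else 0) + ?c * s i * (a j - ?r j)"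
      proof (cases "j = i")
        case True
        then show ?thesis using uv(4)
          by (auto simp: uniform_frame_norm[OF U] algebra_simps)
      next
        case False
        have "s j * a j * (f i \<bullet> f j) = ?c * s i * (s j * s j) * (a j * (if {i, j} = {u, v} then - 1 else 1))"
          using gram[OF i j] False by (simp add: mult_ac)
        also have "a j * (if {i, j} = {u, v} then - 1 else 1) = a j - ?r j"
          by (auto simp: doubleton_eq_iff a_def)
        finally show ?thesis using False by (simp add: ss)
      qed
    qed
    also have "\<dots> = (?d - ?c) * (s i * a i) + ?c * s i * (sum a S - sum ?r S)"
      using i by (simp add: sum.distrib sum_subtractf flip: sum_distrib_left)
    also have "sum ?r S = (if i = u \<or> i = v then 2 * N else 0)"
    proof -
      have "sum ?r S = (\<Sum>j\<in>S. (if j = v then if i = u then 2 * N else 0 else 0) +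
          (if j = u then if i = v then 2 * N else 0 else 0))"
        using uv(4) by (intro sum.cong) auto
      then show ?thesis using uv by (auto simp: sum.distrib)
    qed
    \<comment> \<open>The eigenvalue equation shifted by the identity. In rows \<open>u\<close> and
      \<open>v\<close> it holds by the choice of \<open>a\<close>; in the other rows it says
      \<open>N * (L + 3) = (L + 1)^2\<close>, which is the characteristic equation.\<close>
    also have "sum a S - (if i = u \<or> i = v then 2 * N else 0) = (L + 1) * a i"
    proof (cases "i = u \<or> i = v")
      case True
      then show ?thesis unfolding total by (simp add: a_def algebra_simps)
    next
      case False
      then show ?thesis using L2 unfolding total by (simp add: a_def algebra_simps)
    qed
    finally show "(\<Sum>j\<in>S. s j * a j * (f i \<bullet> f j)) = (?d + ?c * L) * (s i * a i)"
      by (simp add: algebra_simps)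
  qed
qed

section \<open>The maximum over all sets of \<open>m\<close> indices\<close>

theorem theorem5p10:
  fixes f :: "'n::finite \<Rightarrow> real ^ 'k::finite" and m :: nat
  assumes "CARD('k) < CARD('n)"
    and "two_uniform_frame f"
    and "3 \<le> m" and "m \<le> CARD('n)"
    and "\<not> (\<exists>S. card S = m \<and> complete_bipartite S (induced_edges (frame_graph_edges f) S))"
  shows "e_inf m f \<le> real CARD('k) / real CARD('n) + c_nk CARD('n) CARD('k) *
           (real m / 2 - 2 + sqrt ((real m)\<^sup>2 / 4 + real m - 3))
       \<and> ((\<exists>S. card S = m \<and>
              one_edge_from_complete_bipartite S (induced_edges (frame_graph_edges f) S)) \<longrightarrow>
           e_inf m f = real CARD('k) / real CARD('n) + c_nk CARD('n) CARD('k) *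
             (real m / 2 - 2 + sqrt ((real m)\<^sup>2 / 4 + real m - 3)))"
proof -
  let ?B = "real CARD('k) / real CARD('n) + c_nk CARD('n) CARD('k) * seidel_bound m"
  have e: "e_inf m f = Max ((\<lambda>S. onorm (partial_frame_op f S)) ` {S. card S = m})"
    by (simp add: e_inf_def erasure_norm_image_diag01)
  \<comment> \<open>By \<open>m \<le> n\<close> the maximum is taken over a nonempty set, so
    \<open>Max\<close> is a genuine maximum.\<close>
  have ne: "{S :: 'n set. card S = m} \<noteq> {}"
    using obtain_subset_with_card_n[OF assms(4)] by blast
  have le: "e_inf m f \<le> ?B"
    unfolding e using ne assms(5) onorm_le_of_not_complete_bipartite[OF assms(1,2) _ assms(3)]
    by (subst Max_le_iff) auto
  moreover have "e_inf m f = ?B"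
    if "card S = m" "one_edge_from_complete_bipartite S (induced_edges (frame_graph_edges f) S)" for S
  proof (rule antisym[OF le])
    have "?B \<le> onorm (partial_frame_op f S)"
      using that by (intro onorm_ge_of_one_edge_from_complete_bipartite assms)
    also have "\<dots> \<le> e_inf m f"
      unfolding e using that by (intro Max_ge) auto
    finally show "?B \<le> e_inf m f" .
  qed
  ultimately show ?thesis unfolding seidel_bound_def by blast
qed

end
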